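(* Let $\varphi$ be a minimal counterexample to Vaught's conjecture and let $\lambda\in S^\circ=\mathfrak F\cap C_{5.3}\cap(\mathrm{qr}(\varphi),\omega_1)$. Then $|\mathrm{Spec}_\lambda|\le\aleph_0$, where $\mathrm{Spec}_\lambda=\{\mathrm{trace}(M):M\text{ a fiber model at }\lambda\}$.
   Context: Structures are countable structures in a countable vocabulary; classes of models are counted up to isomorphism. $\Sigma^{\mathrm{in}}_0=\Pi^{\mathrm{in}}_0$ is the set of finitary quantifier-free formulas; for $\alpha>0$, $\Sigma^{\mathrm{in}}_\alpha$ consists of countable disjunctions of formulas $\exists\bar x\,\psi$ with $\psi\in\Pi^{\mathrm{in}}_\beta$, $\beta<\alpha$, and $\Pi^{\mathrm{in}}_\alpha$ is dual. $M\equiv_\alpha N$: $M,N$ satisfy the same $\Pi^{\mathrm{in}}_\alpha$ (equivalently $\Sigma^{\mathrm{in}}_\alpha$) sentences. A Scott sentence of $M$ is an $L_{\omega_1\omega}$ sentence whose countable models are exactly the copies of $M$. $\mathrm{cSR}(M)$: the least $\alpha$ such that $M$ has a $\Pi^{\mathrm{in}}_{\alpha+1}$ Scott sentence. $\omega_1^A=\min\{\omega_1^X: X\in 2^\omega\text{ computes a copy of }A\}$. $\mathrm{qr}(S)$: the least $\beta$ with $S\in\Pi^{\mathrm{in}}_\beta\cup\Sigma^{\mathrm{in}}_\beta$. Standing hypotheses: Vaught's conjecture fails, and $\varphi$ is a minimal counterexample: an $L_{\omega_1\omega}$ sentence with exactly $\aleph_1$ countable models up to isomorphism, scattered (for each $\alpha<\omega_1$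 at most countably many $\equiv_\alpha$-classes among its models), and such that for every $L_{\omega_1\omega}$ sentence $\psi$ one of $\varphi\wedge\psi$, $\varphi\wedge\neg\psi$ has only countably many models. Moreover for each $\alpha<\omega_1$ only countably many $\Sigma^{\mathrm{in}}_\alpha$-types are realized in models of $\varphi$. For each $\beta<\omega_1$ exactly one $\equiv_\beta$-class of models of $\varphi$ is uncountable, denoted $\mathcal C_\beta$. $f(\alpha)=\min\{\beta:(\forall M\models\varphi)(M\notin\mathcal C_\alpha\Rightarrow\mathrm{cSR}(M)<\beta)\}$, $\mathfrak F=\{\alpha<\omega_1:f(\alpha)\le\alpha\}$. Sacks rank. A fragment is a countable set of $L_{\omega_1\omega}$ formulas closed under subformulas, substitution and the finitary connectives and quantifiers. For a structure $A$: $L^A_0$ is the finitary language; $T^A_\delta=\mathrm{Th}_{L^A_\delta}(A)$; $L^A_{\delta+1}$ is the least fragment containing $L^A_\delta$ and $\bigwedge p$ for every non-principal complete $L^A_\delta$-type $p$ realized in $A$; unions at limits. $\mathrm{sr}_{\mathrm{Sacks}}(A)$ is the least $\delta$ such that $A$ is the atomic model of $T^A_\delta$. Tree of nodes. $L_0$ is the fragment generated by $\varphi$, and $T$ is $\{\varphi\}$ together with the tautologies of $L_0$. A theory $T'$ in a fragment $L'$ is $\omega$-complete if for each sentence $F\in L'$, $F\in T'$ or $\neg F\in T'$, and whenever $\bigvee_iF_i\in T'$, some $F_i\in T'$; it is finitarily consistent if no contradiction is derivable from it by finite-length deductions. Nodes on level $0$: finitarily consistent $\omega$-complete extensions of $T$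 in $L_0$. An $n$-type of a node $S$ (in fragment $L_S$) is a maximal set of $L_S(\bar x)$-formulas finitarily consistent with $S$; it is principal if generated over $S$ by one of its formulas. Nodes on level $\delta+1$: finitarily consistent $\omega$-complete extensions of a level-$\delta$ node $S$ in $L'_S$, the least fragment containing $L_S$ and $\bigwedge p$ for each non-principal $n$-type $p$ of $S$. Nodes on limit levels: unions along chains. Every model of a node is a model of $\varphi$. Fixed data, supplied by a theorem of Sacks (Bounds on weak scattering, Prop. 5.2 and Thm. 5.3): an increasing branch $(T_\delta)_{\delta<\omega_1}$ of nodes, $T_\delta$ on level $\delta$, unions at limits, $\Delta_1$ over $L(\omega_1,T)$, such that every $T_\delta$ has an atomic model of $\mathrm{sr}_{\mathrm{Sacks}}$ exactly $\delta$; and a club $C_{5.3}\subseteq\omega_1$ (the ordinals $\omega_1^{L(\beta_\delta,T)}$ for the transitive collapses $L(\beta_\delta,T)$ of the $\Sigma_1$-hulls in Sacks' proof) such that for each $\lambda\in C_{5.3}$: $\lambda>\omega$ and $L(\lambda,T)$ is $\Sigma_1$-admissible; and the set of non-principal $n$-types of $T_\lambda$ is non-empty and countable. For $\lambda\in S^\circ$: $N$ is the set of non-principal $n$-types (all $n\ge1$) of $T_\lambda$. The fiber at $\lambda$ is the class of countable $M$ with $M\models T_\lambda$ and $\omega_1^M=\lambda$; its members are fiber models. For a fiber model $M$, $\mathrm{trace}(M)=\{p\in N:M\text{ realizes }p\}$. *)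

theory Defs
  imports
    "HOL-Library.Countable_Set_Type"
    "HOL-Library.Nat_Bijection"
    "HOL-Library.Equipollence"
begin

section \<open>Countable ordinals\<close>

text \<open>The elements of the initial ordinal of the cardinal successor of \<open>\<aleph>\<^sub>0\<close>.\<close>

typedef omega1 = "Field (cardSuc natLeq)"
  using Field_cardSuc_not_empty[OF natLeq_Card_order] by blast

lemma Card_order_cardSuc_natLeq: "Card_order (cardSuc natLeq)"
  by (rule cardSuc_Card_order[OF natLeq_Card_order])

instantiation omega1 :: wellorder
begin

definition less_eq_omega1 :: "omega1 \<Rightarrow> omega1 \<Rightarrow> bool" where
  "a \<le> b \<longleftrightarrow> (Rep_omega1 a, Rep_omega1 b) \<in> cardSuc natLeq"

definition less_omega1 :: "omega1 \<Rightarrow> omega1 \<Rightarrow> bool" where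
  "a < b \<longleftrightarrow> a \<le> b \<and> \<not> b \<le> (a::omega1)"

instance
proof -
  let ?r = "cardSuc natLeq"
  have wo: "Well_order ?r"
    using Card_order_cardSuc_natLeq by (simp add: card_order_on_def)
  then have lin: "Linear_order ?r" and wf: "wf (?r - Id)"
    by (auto simp: well_order_on_def)
  from lin have refl: "refl_on (Field ?r) ?r" and tr: "trans ?r" and anti: "antisym ?r"
    and tot: "total_on (Field ?r) ?r"
    by (auto simp: linear_order_on_def partial_order_on_def preorder_on_def)
  show "OFCLASS(omega1, wellorder_class)"
  proof
    fix x y z :: omega1
    show "x < y \<longleftrightarrow> x \<le> y \<and> \<not> y \<le> x" by (rule less_omega1_def)
    show "x \<le> x"
      using refl Rep_omega1[of x] by (auto simp: less_eq_omega1_def refl_on_def)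
    show "x \<le> y \<Longrightarrow> y \<le> z \<Longrightarrow> x \<le> z"
      using tr by (auto simp: less_eq_omega1_def dest: transD)
    show "x \<le> y \<Longrightarrow> y \<le> x \<Longrightarrow> x = y"
      using anti by (auto simp: less_eq_omega1_def Rep_omega1_inject dest: antisymD)
    show "x \<le> y \<or> y \<le> x"
    proof (cases "x = y")
      case True
      then show ?thesis
        using refl Rep_omega1[of x] by (auto simp: less_eq_omega1_def refl_on_def)
    next
      case False
      then show ?thesis
        using tot Rep_omega1[of x] Rep_omega1[of y]
        by (auto simp: less_eq_omega1_def total_on_def Rep_omega1_inject)
    qed
  next
    fix P :: "omega1 \<Rightarrow> bool" and a :: omega1
    assume step: "\<And>x. (\<And>y. y < x \<Longrightarrow> P y) \<Longrightarrow> P x"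
    have sub: "{(x::omega1, y). x < y} \<subseteq> inv_image (?r - Id) Rep_omega1"
      using refl Rep_omega1
      by (auto simp: less_omega1_def less_eq_omega1_def inv_image_def refl_on_def
          Rep_omega1_inject)
    have "wf {(x::omega1, y). x < y}"
      by (rule wf_subset[OF wf_inv_image[OF wf] sub])
    then show "P a"
      by (rule wf_induct_rule) (use step in auto)
  qed
qed

end

instantiation omega1 :: zero
begin

definition zero_omega1 :: omega1 where
  "0 = (LEAST a::omega1. True)"

instance ..

end

lemma omega1_no_max: "\<exists>b. a < (b::omega1)"
proof -
  have "\<not> finite (Field (cardSuc natLeq))"
    using cardSuc_finite[OF natLeq_Card_order] by (simp add: Field_natLeq)
  from infinite_Card_order_limit[OF Card_order_cardSuc_natLeq this Rep_omega1[of a]]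
  obtain b where b: "b \<in> Field (cardSuc natLeq)" "Rep_omega1 a \<noteq> b"
    "(Rep_omega1 a, b) \<in> cardSuc natLeq" by blast
  then have "a \<le> Abs_omega1 b" "a \<noteq> Abs_omega1 b"
    by (auto simp: less_eq_omega1_def Abs_omega1_inverse)
  then show ?thesis by (metis order_le_imp_less_or_eq)
qed

definition osucc :: "omega1 \<Rightarrow> omega1" where
  "osucc a = (LEAST b. a < b)"

lemma less_osucc: "a < osucc a"
  unfolding osucc_def by (rule LeastI_ex) (rule omega1_no_max)

lemma osucc_le: "a < b \<Longrightarrow> osucc a \<le> b"
  unfolding osucc_def by (rule Least_le)

lemma osucc_inject: "osucc a = osucc b \<longleftrightarrow> a = b"
  by (metis less_osucc linorder_neqE not_less osucc_le)

definition is_limit :: "omega1 \<Rightarrow> bool" where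
  "is_limit a \<longleftrightarrow> a \<noteq> 0 \<and> (\<forall>b<a. osucc b < a)"

definition omega :: omega1 where
  "omega = (LEAST a. is_limit a)"

definition opred :: "omega1 \<Rightarrow> omega1" where
  "opred a = (THE b. a = osucc b)"

lemma opred_osucc: "opred (osucc a) = a"
  by (auto simp: opred_def osucc_inject)

function trec :: "'a set \<Rightarrow> ('a set \<Rightarrow> 'a set) \<Rightarrow> omega1 \<Rightarrow> 'a set" where
  "trec Z F a =
     (if a = 0 then Z
      else if \<exists>b. a = osucc b then F (trec Z F (opred a))
      else (\<Union>b\<in>{..<a}. trec Z F b))"
  by pat_completeness auto
termination
  by (relation "inv_image {(b, a). b < a} (\<lambda>(Z, F, a). a)")
    (auto simp: wf opred_osucc less_osucc intro!: wf_inv_image)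

declare trec.simps [simp del]

definition club :: "omega1 set \<Rightarrow> bool" where
  "club C \<longleftrightarrow> (\<forall>a. \<exists>c\<in>C. a < c) \<and>
     (\<forall>l. is_limit l \<longrightarrow> (\<forall>a<l. \<exists>c\<in>C. a < c \<and> c < l) \<longrightarrow> l \<in> C)"

definition has_otype :: "nat rel \<Rightarrow> omega1 \<Rightarrow> bool" where
  "has_otype r a \<longleftrightarrow> Well_order r \<and>
     (\<exists>h. bij_betw h (Field r) {..<a} \<and>
          (\<forall>x\<in>Field r. \<forall>y\<in>Field r. (x, y) \<in> r \<longleftrightarrow> h x \<le> h y))"

section \<open>Formulas of \<open>L\<^bsub>\<omega>\<^sub>1\<omega>\<^esub>\<close>\<close>

text \<open>The symbols of a countable vocabulary are natural numbers; the maps give the arities of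
  the symbols that are present. Constants are function symbols of arity \<open>0\<close>.\<close>

record vocab =
  fun_ar :: "nat \<Rightarrow> nat option"
  rel_ar :: "nat \<Rightarrow> nat option"

text \<open>Variables are de Bruijn indices, so formulas are identified up to renaming of bound
  variables. The connectives \<open>Conj\<close> and \<open>Disj\<close> take countable sets of formulas.\<close>

datatype tm = Var nat | Fn nat "tm list"

datatype fm =
    Eq tm tm
  | Rel nat "tm list"
  | Neg fm
  | Conj "fm cset"
  | Disj "fm cset"
  | Ex fm
  | All fm

definition Bot :: fm where "Bot = Disj cempty"

definition And :: "fm \<Rightarrow> fm \<Rightarrow> fm" where "And f g = Conj (cinsert f (csingle g))"

definition Imp :: "fm \<Rightarrow> fm \<Rightarrow> fm" where "Imp f g = Disj (cinsert (Neg f) (csingle g))"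

definition Exs :: "nat \<Rightarrow> fm \<Rightarrow> fm" where "Exs n = Ex ^^ n"

definition Alls :: "nat \<Rightarrow> fm \<Rightarrow> fm" where "Alls n = All ^^ n"

primrec fv_tm :: "tm \<Rightarrow> nat set" where
  "fv_tm (Var n) = {n}"
| "fv_tm (Fn k ts) = \<Union> (set (map fv_tm ts))"

primrec fv :: "fm \<Rightarrow> nat set" where
  "fv (Eq s t) = fv_tm s \<union> fv_tm t"
| "fv (Rel k ts) = \<Union> (fv_tm ` set ts)"
| "fv (Neg f) = fv f"
| "fv (Conj S) = \<Union> (rcset (cimage fv S))"
| "fv (Disj S) = \<Union> (rcset (cimage fv S))"
| "fv (Ex f) = {n. Suc n \<in> fv f}"
| "fv (All f) = {n. Suc n \<in> fv f}"

primrec wf_tm :: "vocab \<Rightarrow> tm \<Rightarrow> bool" where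
  "wf_tm V (Var n) \<longleftrightarrow> True"
| "wf_tm V (Fn k ts) \<longleftrightarrow> fun_ar V k = Some (length ts) \<and> list_all id (map (wf_tm V) ts)"

primrec in_sig :: "vocab \<Rightarrow> fm \<Rightarrow> bool" where
  "in_sig V (Eq s t) \<longleftrightarrow> wf_tm V s \<and> wf_tm V t"
| "in_sig V (Rel k ts) \<longleftrightarrow> rel_ar V k = Some (length ts) \<and> (\<forall>t\<in>set ts. wf_tm V t)"
| "in_sig V (Neg f) \<longleftrightarrow> in_sig V f"
| "in_sig V (Conj S) \<longleftrightarrow> (\<forall>b\<in>rcset (cimage (in_sig V) S). b)"
| "in_sig V (Disj S) \<longleftrightarrow> (\<forall>b\<in>rcset (cimage (in_sig V) S). b)"
| "in_sig V (Ex f) \<longleftrightarrow> in_sig V f"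
| "in_sig V (All f) \<longleftrightarrow> in_sig V f"

text \<open>As usual, a formula of \<open>L\<^bsub>\<omega>\<^sub>1\<omega>\<^esub>\<close> has only finitely many free variables; this property is
  inherited by all its subformulas.\<close>

definition wff :: "vocab \<Rightarrow> fm \<Rightarrow> bool" where
  "wff V f \<longleftrightarrow> in_sig V f \<and> finite (fv f)"

definition sentence :: "vocab \<Rightarrow> fm \<Rightarrow> bool" where
  "sentence V f \<longleftrightarrow> in_sig V f \<and> fv f = {}"

primrec subst_tm :: "tm \<Rightarrow> (nat \<Rightarrow> tm) \<Rightarrow> tm" where
  "subst_tm (Var n) s = s n"
| "subst_tm (Fn k ts) s = Fn k (map (\<lambda>t. subst_tm t s) ts)"

definition lift_tm :: "tm \<Rightarrow> tm" where
  "lift_tm t = subst_tm t (\<lambda>n. Var (Suc n))"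

definition up :: "(nat \<Rightarrow> tm) \<Rightarrow> nat \<Rightarrow> tm" where
  "up s = case_nat (Var 0) (\<lambda>n. lift_tm (s n))"

primrec subst :: "fm \<Rightarrow> (nat \<Rightarrow> tm) \<Rightarrow> fm" where
  "subst (Eq t u) s = Eq (subst_tm t s) (subst_tm u s)"
| "subst (Rel k ts) s = Rel k (map (\<lambda>t. subst_tm t s) ts)"
| "subst (Neg f) s = Neg (subst f s)"
| "subst (Conj S) s = Conj (cimage (\<lambda>f. subst f s) S)"
| "subst (Disj S) s = Disj (cimage (\<lambda>f. subst f s) S)"
| "subst (Ex f) s = Ex (subst f (up s))"
| "subst (All f) s = All (subst f (up s))"

definition lift :: "fm \<Rightarrow> fm" where
  "lift f = subst f (\<lambda>n. Var (Suc n))"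

definition inst :: "fm \<Rightarrow> tm \<Rightarrow> fm" where
  "inst f t = subst f (case_nat t Var)"

section \<open>Countable structures\<close>

text \<open>Every countable structure is isomorphic to one whose domain is a set of natural numbers.
  Values of the interpretations outside the vocabulary or the domain are irrelevant.\<close>

record struc =
  Dom :: "nat set"
  funI :: "nat \<Rightarrow> nat list \<Rightarrow> nat"
  relI :: "nat \<Rightarrow> nat list \<Rightarrow> bool"

definition is_struc :: "vocab \<Rightarrow> struc \<Rightarrow> bool" where
  "is_struc V M \<longleftrightarrow> Dom M \<noteq> {} \<and>
     (\<forall>k xs. fun_ar V k = Some (length xs) \<and> set xs \<subseteq> Dom M \<longrightarrow> funI M k xs \<in> Dom M)"

primrec val :: "struc \<Rightarrow> (nat \<Rightarrow> nat) \<Rightarrow> tm \<Rightarrow> nat" where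
  "val M e (Var n) = e n"
| "val M e (Fn k ts) = funI M k (map (val M e) ts)"

primrec sat :: "struc \<Rightarrow> fm \<Rightarrow> (nat \<Rightarrow> nat) \<Rightarrow> bool" where
  "sat M (Eq s t) e \<longleftrightarrow> val M e s = val M e t"
| "sat M (Rel k ts) e \<longleftrightarrow> relI M k (map (val M e) ts)"
| "sat M (Neg f) e \<longleftrightarrow> \<not> sat M f e"
| "sat M (Conj S) e \<longleftrightarrow> (\<forall>b\<in>rcset (cimage (\<lambda>f. sat M f e) S). b)"
| "sat M (Disj S) e \<longleftrightarrow> (\<exists>b\<in>rcset (cimage (\<lambda>f. sat M f e) S). b)"
| "sat M (Ex f) e \<longleftrightarrow> (\<exists>a\<in>Dom M. sat M f (case_nat a e))"
| "sat M (All f) e \<longleftrightarrow> (\<forall>a\<in>Dom M. sat M f (case_nat a e))"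

definition assigns :: "struc \<Rightarrow> (nat \<Rightarrow> nat) set" where
  "assigns M = {e. range e \<subseteq> Dom M}"

definition models :: "struc \<Rightarrow> fm \<Rightarrow> bool" where
  "models M f \<longleftrightarrow> (\<forall>e\<in>assigns M. sat M f e)"

definition Mod :: "vocab \<Rightarrow> fm \<Rightarrow> struc set" where
  "Mod V f = {M. is_struc V M \<and> models M f}"

definition iso :: "vocab \<Rightarrow> struc \<Rightarrow> struc \<Rightarrow> bool" where
  "iso V M N \<longleftrightarrow> (\<exists>h. bij_betw h (Dom M) (Dom N) \<and>
     (\<forall>k xs. fun_ar V k = Some (length xs) \<and> set xs \<subseteq> Dom M \<longrightarrow>
        h (funI M k xs) = funI N k (map h xs)) \<and>
     (\<forall>k xs. rel_ar V k = Some (length xs) \<and> set xs \<subseteq> Dom M \<longrightarrow>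
        relI M k xs = relI N k (map h xs)))"

definition iso_rel :: "vocab \<Rightarrow> struc rel" where
  "iso_rel V = {(M, N). is_struc V M \<and> is_struc V N \<and> iso V M N}"

definition iso_types :: "vocab \<Rightarrow> struc set \<Rightarrow> struc set set" where
  "iso_types V K = K // iso_rel V"

section \<open>The hierarchy of infinitary formulas and Scott rank\<close>

primrec finitary_qf :: "fm \<Rightarrow> bool" where
  "finitary_qf (Eq s t) \<longleftrightarrow> True"
| "finitary_qf (Rel k ts) \<longleftrightarrow> True"
| "finitary_qf (Neg f) \<longleftrightarrow> finitary_qf f"
| "finitary_qf (Conj S) \<longleftrightarrow> finite (rcset S) \<and> (\<forall>b\<in>rcset (cimage finitary_qf S). b)"
| "finitary_qf (Disj S) \<longleftrightarrow> finite (rcset S) \<and> (\<forall>b\<in>rcset (cimage finitary_qf S). b)"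
| "finitary_qf (Ex f) \<longleftrightarrow> False"
| "finitary_qf (All f) \<longleftrightarrow> False"

inductive sigma_in :: "omega1 \<Rightarrow> fm \<Rightarrow> bool" and pi_in :: "omega1 \<Rightarrow> fm \<Rightarrow> bool" where
  sigma_0: "finitary_qf f \<Longrightarrow> sigma_in 0 f"
| pi_0: "finitary_qf f \<Longrightarrow> pi_in 0 f"
| sigma_pos: "0 < a \<Longrightarrow> \<forall>f\<in>rcset S. \<exists>b<a. \<exists>n g. f = Exs n g \<and> pi_in b g
    \<Longrightarrow> sigma_in a (Disj S)"
| pi_pos: "0 < a \<Longrightarrow> \<forall>f\<in>rcset S. \<exists>b<a. \<exists>n g. f = Alls n g \<and> sigma_in b g
    \<Longrightarrow> pi_in a (Conj S)"

definition equiv_in :: "vocab \<Rightarrow> omega1 \<Rightarrow> struc \<Rightarrow> struc \<Rightarrow> bool" where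
  "equiv_in V a M N \<longleftrightarrow> (\<forall>f. sentence V f \<and> pi_in a f \<longrightarrow> (models M f \<longleftrightarrow> models N f))"

definition equiv_classes :: "vocab \<Rightarrow> fm \<Rightarrow> omega1 \<Rightarrow> struc set set" where
  "equiv_classes V \<phi> a =
     Mod V \<phi> // {(M, N). M \<in> Mod V \<phi> \<and> N \<in> Mod V \<phi> \<and> equiv_in V a M N}"

definition scott_sentence :: "vocab \<Rightarrow> fm \<Rightarrow> struc \<Rightarrow> bool" where
  "scott_sentence V f M \<longleftrightarrow>
     sentence V f \<and> (\<forall>N. is_struc V N \<longrightarrow> (models N f \<longleftrightarrow> iso V M N))"

definition cSR :: "vocab \<Rightarrow> struc \<Rightarrow> omega1" where
  "cSR V M = (LEAST a. \<exists>f. pi_in (osucc a) f \<and> scott_sentence V f M)"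

text \<open>Membership of a sentence in one of the classes is read up to logical equivalence, since the
  classes consist of formulas in a normal form. By Loewenheim--Skolem, equivalence over countable
  structures is the same as equivalence over all structures.\<close>

definition qr :: "vocab \<Rightarrow> fm \<Rightarrow> omega1" where
  "qr V S = (LEAST b. \<exists>f. sentence V f \<and> (pi_in b f \<or> sigma_in b f) \<and> Mod V f = Mod V S)"

definition sigma_type :: "omega1 \<Rightarrow> nat \<Rightarrow> vocab \<Rightarrow> struc \<Rightarrow> (nat \<Rightarrow> nat) \<Rightarrow> fm set" where
  "sigma_type a n V M e = {f. wff V f \<and> sigma_in a f \<and> fv f \<subseteq> {..<n} \<and> sat M f e}"

section \<open>Minimal counterexamples to Vaught's conjecture\<close>

definition scattered :: "vocab \<Rightarrow> fm \<Rightarrow> bool" where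
  "scattered V \<phi> \<longleftrightarrow> (\<forall>a. countable (equiv_classes V \<phi> a))"

definition minimal_counterexample :: "vocab \<Rightarrow> fm \<Rightarrow> bool" where
  "minimal_counterexample V \<phi> \<longleftrightarrow>
     sentence V \<phi> \<and>
     iso_types V (Mod V \<phi>) \<approx> (UNIV :: omega1 set) \<and>
     scattered V \<phi> \<and>
     (\<forall>\<psi>. sentence V \<psi> \<longrightarrow>
        countable (iso_types V (Mod V (And \<phi> \<psi>))) \<or>
        countable (iso_types V (Mod V (And \<phi> (Neg \<psi>))))) \<and>
     (\<forall>a. countable {sigma_type a n V M e | n M e. M \<in> Mod V \<phi> \<and> e \<in> assigns M}) \<and>
     (\<forall>b. \<exists>!K. K \<in> equiv_classes V \<phi> b \<and> \<not> countable (iso_types V K))"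

definition big_class :: "vocab \<Rightarrow> fm \<Rightarrow> omega1 \<Rightarrow> struc set" where
  "big_class V \<phi> b = (THE K. K \<in> equiv_classes V \<phi> b \<and> \<not> countable (iso_types V K))"

definition ff :: "vocab \<Rightarrow> fm \<Rightarrow> omega1 \<Rightarrow> omega1" where
  "ff V \<phi> a = (LEAST b. \<forall>M\<in>Mod V \<phi>. M \<notin> big_class V \<phi> a \<longrightarrow> cSR V M < b)"

definition FF :: "vocab \<Rightarrow> fm \<Rightarrow> omega1 set" where
  "FF V \<phi> = {a. ff V \<phi> a \<le> a}"

section \<open>Finite deductions\<close>

text \<open>Keisler's axiomatization of \<open>L\<^bsub>\<omega>\<^sub>1\<omega>\<^esub>\<close> without its infinitary rule, in natural deduction form:
  deductions are finite, infinite conjunctions and disjunctions only have the axioms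
  \<open>\<And>\<Phi> \<rightarrow> f\<close>, \<open>f \<rightarrow> \<Or>\<Phi>\<close> (for \<open>f \<in> \<Phi>\<close>) and the axioms moving negations inside.\<close>

inductive derives :: "vocab \<Rightarrow> fm set \<Rightarrow> fm \<Rightarrow> bool" for V where
  assm: "f \<in> \<Gamma> \<Longrightarrow> derives V \<Gamma> f"
| ccontr: "wff V f \<Longrightarrow> derives V (insert (Neg f) \<Gamma>) Bot \<Longrightarrow> derives V \<Gamma> f"
| negI: "wff V f \<Longrightarrow> derives V (insert f \<Gamma>) Bot \<Longrightarrow> derives V \<Gamma> (Neg f)"
| negE: "derives V \<Gamma> (Neg f) \<Longrightarrow> derives V \<Gamma> f \<Longrightarrow> derives V \<Gamma> Bot"
| conjI: "finite (rcset S) \<Longrightarrow> \<forall>f\<in>rcset S. derives V \<Gamma> f \<Longrightarrow> derives V \<Gamma> (Conj S)"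
| conjE: "derives V \<Gamma> (Conj S) \<Longrightarrow> f \<in> rcset S \<Longrightarrow> derives V \<Gamma> f"
| disjI: "wff V (Disj S) \<Longrightarrow> f \<in> rcset S \<Longrightarrow> derives V \<Gamma> f \<Longrightarrow> derives V \<Gamma> (Disj S)"
| disjE: "finite (rcset S) \<Longrightarrow> derives V \<Gamma> (Disj S) \<Longrightarrow> wff V g \<Longrightarrow>
    \<forall>f\<in>rcset S. derives V (insert f \<Gamma>) g \<Longrightarrow> derives V \<Gamma> g"
| neg_Conj: "derives V \<Gamma> (Neg (Conj S)) \<Longrightarrow> derives V \<Gamma> (Disj (cimage Neg S))"
| Disj_neg: "derives V \<Gamma> (Disj (cimage Neg S)) \<Longrightarrow> derives V \<Gamma> (Neg (Conj S))"
| neg_Disj: "derives V \<Gamma> (Neg (Disj S)) \<Longrightarrow> derives V \<Gamma> (Conj (cimage Neg S))"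
| Conj_neg: "derives V \<Gamma> (Conj (cimage Neg S)) \<Longrightarrow> derives V \<Gamma> (Neg (Disj S))"
| allI: "derives V (lift ` \<Gamma>) f \<Longrightarrow> derives V \<Gamma> (All f)"
| allE: "derives V \<Gamma> (All f) \<Longrightarrow> wf_tm V t \<Longrightarrow> derives V \<Gamma> (inst f t)"
| exI: "wff V (Ex f) \<Longrightarrow> wf_tm V t \<Longrightarrow> derives V \<Gamma> (inst f t) \<Longrightarrow> derives V \<Gamma> (Ex f)"
| exE: "derives V \<Gamma> (Ex f) \<Longrightarrow> wff V g \<Longrightarrow> derives V (insert f (lift ` \<Gamma>)) (lift g) \<Longrightarrow>
    derives V \<Gamma> g"
| eq_refl: "wf_tm V t \<Longrightarrow> derives V \<Gamma> (Eq t t)"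
| eq_subst: "wff V f \<Longrightarrow> derives V \<Gamma> (Eq s t) \<Longrightarrow> derives V \<Gamma> (inst f s) \<Longrightarrow>
    derives V \<Gamma> (inst f t)"

text \<open>Free variables of the hypotheses act as parameters, so this also makes sense for types.\<close>

definition fin_consistent :: "vocab \<Rightarrow> fm set \<Rightarrow> bool" where
  "fin_consistent V \<Gamma> \<longleftrightarrow> \<not> derives V \<Gamma> Bot"

section \<open>Fragments and types\<close>

text \<open>Fragments contain, as usual, the atomic and hence all finitary formulas of the
  vocabulary.\<close>

definition fragment :: "vocab \<Rightarrow> fm set \<Rightarrow> bool" where
  "fragment V L \<longleftrightarrow>
     countable L \<and>
     (\<forall>f\<in>L. wff V f) \<and>
     (\<forall>s t. wf_tm V s \<and> wf_tm V t \<longrightarrow> Eq s t \<in> L) \<and>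
     (\<forall>k ts. rel_ar V k = Some (length ts) \<and> (\<forall>t\<in>set ts. wf_tm V t) \<longrightarrow> Rel k ts \<in> L) \<and>
     (\<forall>f. Neg f \<in> L \<longrightarrow> f \<in> L) \<and>
     (\<forall>S. Conj S \<in> L \<longrightarrow> rcset S \<subseteq> L) \<and>
     (\<forall>S. Disj S \<in> L \<longrightarrow> rcset S \<subseteq> L) \<and>
     (\<forall>f. Ex f \<in> L \<longrightarrow> f \<in> L) \<and>
     (\<forall>f. All f \<in> L \<longrightarrow> f \<in> L) \<and>
     (\<forall>f\<in>L. \<forall>s. (\<forall>n. wf_tm V (s n)) \<longrightarrow> subst f s \<in> L) \<and>
     (\<forall>f\<in>L. Neg f \<in> L) \<and>
     (\<forall>S. finite (rcset S) \<and> rcset S \<subseteq> L \<longrightarrow> Conj S \<in> L \<and> Disj S \<in> L) \<and>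
     (\<forall>f\<in>L. Ex f \<in> L \<and> All f \<in> L)"

definition frag_gen :: "vocab \<Rightarrow> fm set \<Rightarrow> fm set" where
  "frag_gen V X = \<Inter> {L. fragment V L \<and> X \<subseteq> L}"

definition sentences :: "vocab \<Rightarrow> fm set \<Rightarrow> fm set" where
  "sentences V L = {f \<in> L. sentence V f}"

definition formulas_in :: "fm set \<Rightarrow> nat \<Rightarrow> fm set" where
  "formulas_in L n = {f \<in> L. fv f \<subseteq> {..<n}}"

text \<open>For the finitarily deductively closed theories considered here, derivability of a sentence
  of the fragment is membership.\<close>

definition generates :: "vocab \<Rightarrow> fm set \<Rightarrow> nat \<Rightarrow> fm \<Rightarrow> fm set \<Rightarrow> bool" where
  "generates V S n f p \<longleftrightarrow> (\<forall>g\<in>p. derives V S (Alls n (Imp f g)))"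

definition principal :: "vocab \<Rightarrow> fm set \<Rightarrow> nat \<Rightarrow> fm set \<Rightarrow> bool" where
  "principal V S n p \<longleftrightarrow> (\<exists>f\<in>p. generates V S n f p)"

definition type_of :: "fm set \<Rightarrow> nat \<Rightarrow> struc \<Rightarrow> (nat \<Rightarrow> nat) \<Rightarrow> fm set" where
  "type_of L n M e = {f \<in> formulas_in L n. sat M f e}"

definition models_all :: "vocab \<Rightarrow> struc \<Rightarrow> fm set \<Rightarrow> bool" where
  "models_all V M S \<longleftrightarrow> is_struc V M \<and> (\<forall>f\<in>S. models M f)"

definition atomic_model :: "vocab \<Rightarrow> fm set \<Rightarrow> fm set \<Rightarrow> struc \<Rightarrow> bool" where
  "atomic_model V L S M \<longleftrightarrow> models_all V M S \<and>
     (\<forall>n\<ge>1. \<forall>e\<in>assigns M. principal V S n (type_of L n M e))"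

section \<open>Sacks rank\<close>

definition Th :: "vocab \<Rightarrow> fm set \<Rightarrow> struc \<Rightarrow> fm set" where
  "Th V L A = {f \<in> sentences V L. models A f}"

definition next_L :: "vocab \<Rightarrow> struc \<Rightarrow> fm set \<Rightarrow> fm set" where
  "next_L V A L = frag_gen V (L \<union>
     {Conj (acset p) | p. \<exists>n\<ge>1. \<exists>e\<in>assigns A. p = type_of L n A e \<and>
        \<not> principal V (Th V L A) n p})"

definition L_struc :: "vocab \<Rightarrow> struc \<Rightarrow> omega1 \<Rightarrow> fm set" where
  "L_struc V A = trec (frag_gen V {}) (next_L V A)"

definition sr_Sacks :: "vocab \<Rightarrow> struc \<Rightarrow> omega1" where
  "sr_Sacks V A = (LEAST d. atomic_model V (L_struc V A d) (Th V (L_struc V A d) A) A)"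

section \<open>The tree of nodes\<close>

definition omega_complete :: "vocab \<Rightarrow> fm set \<Rightarrow> fm set \<Rightarrow> bool" where
  "omega_complete V L S \<longleftrightarrow> S \<subseteq> sentences V L \<and>
     (\<forall>f\<in>sentences V L. f \<in> S \<or> Neg f \<in> S) \<and>
     (\<forall>F. Disj F \<in> S \<longrightarrow> (\<exists>f\<in>rcset F. f \<in> S))"

definition base_L :: "vocab \<Rightarrow> fm \<Rightarrow> fm set" where
  "base_L V \<phi> = frag_gen V {\<phi>}"

text \<open>\<open>\<phi>\<close> together with the logically valid sentences of its fragment (again countable structures
  suffice).\<close>

definition base_T :: "vocab \<Rightarrow> fm \<Rightarrow> fm set" where
  "base_T V \<phi> = {\<phi>} \<union> {f \<in> sentences V (base_L V \<phi>). \<forall>M. is_struc V M \<longrightarrow> models M f}"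

definition node_type :: "vocab \<Rightarrow> fm set \<Rightarrow> fm set \<Rightarrow> nat \<Rightarrow> fm set \<Rightarrow> bool" where
  "node_type V L S n p \<longleftrightarrow> p \<subseteq> formulas_in L n \<and> fin_consistent V (S \<union> p) \<and>
     (\<forall>q. p \<subseteq> q \<and> q \<subseteq> formulas_in L n \<and> fin_consistent V (S \<union> q) \<longrightarrow> q = p)"

definition nonprincipal_types :: "vocab \<Rightarrow> fm set \<Rightarrow> fm set \<Rightarrow> fm set set" where
  "nonprincipal_types V L S = {p. \<exists>n\<ge>1. node_type V L S n p \<and> \<not> principal V S n p}"

text \<open>\<open>L'\<close> exists as a fragment only if \<open>S\<close> has countably many non-principal types.\<close>

definition child :: "vocab \<Rightarrow> fm set \<Rightarrow> fm set \<Rightarrow> fm set \<Rightarrow> fm set \<Rightarrow> bool" where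
  "child V L S L' S' \<longleftrightarrow>
     L' = frag_gen V (L \<union> (\<lambda>p. Conj (acset p)) ` nonprincipal_types V L S) \<and>
     fragment V L' \<and> S \<subseteq> S' \<and> omega_complete V L' S' \<and> fin_consistent V S'"

text \<open>\<open>node V \<phi> \<delta> L S\<close>: \<open>S\<close> is a node on level \<open>\<delta>\<close>, with fragment \<open>L\<close>.\<close>

inductive node :: "vocab \<Rightarrow> fm \<Rightarrow> omega1 \<Rightarrow> fm set \<Rightarrow> fm set \<Rightarrow> bool" for V \<phi> where
  node_0: "base_T V \<phi> \<subseteq> S \<Longrightarrow> omega_complete V (base_L V \<phi>) S \<Longrightarrow> fin_consistent V S \<Longrightarrow>
    node V \<phi> 0 (base_L V \<phi>) S"
| node_succ: "node V \<phi> d L S \<Longrightarrow> child V L S L' S' \<Longrightarrow> node V \<phi> (osucc d) L' S'"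
| node_limit: "is_limit l \<Longrightarrow> \<forall>d<l. node V \<phi> d (Ls d) (Ss d) \<Longrightarrow>
    \<forall>d<l. \<forall>d'\<le>d. Ls d' \<subseteq> Ls d \<and> Ss d' \<subseteq> Ss d \<Longrightarrow>
    node V \<phi> l (\<Union>d\<in>{..<l}. Ls d) (\<Union>d\<in>{..<l}. Ss d)"

section \<open>Hereditarily countable sets and relative constructibility\<close>

datatype hc = HC (helts: "hc cset")

definition elts :: "hc \<Rightarrow> hc set" where
  "elts x = rcset (helts x)"

text \<open>Meant for countable sets only.\<close>

definition hset :: "hc set \<Rightarrow> hc" where
  "hset X = HC (acset X)"

definition hpair :: "hc \<Rightarrow> hc \<Rightarrow> hc" where
  "hpair x y = hset {hset {x}, hset {x, y}}"

function hord :: "omega1 \<Rightarrow> hc" where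
  "hord a = hset (hord ` {..<a})"
  by pat_completeness auto
termination
  by (relation "{(b, a). b < a}") (auto simp: wf)

declare hord.simps [simp del]

primrec hnat :: "nat \<Rightarrow> hc" where
  "hnat 0 = hset {}"
| "hnat (Suc n) = hset (insert (hnat n) (elts (hnat n)))"

primrec hlist :: "hc list \<Rightarrow> hc" where
  "hlist [] = hset {}"
| "hlist (x # xs) = hpair x (hlist xs)"

primrec code_tm :: "tm \<Rightarrow> hc" where
  "code_tm (Var n) = hpair (hnat 0) (hnat n)"
| "code_tm (Fn k ts) = hpair (hnat 1) (hpair (hnat k) (hlist (map code_tm ts)))"

primrec code_fm :: "fm \<Rightarrow> hc" where
  "code_fm (Eq s t) = hpair (hnat 0) (hpair (code_tm s) (code_tm t))"
| "code_fm (Rel k ts) = hpair (hnat 1) (hpair (hnat k) (hlist (map code_tm ts)))"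
| "code_fm (Neg f) = hpair (hnat 2) (code_fm f)"
| "code_fm (Conj S) = hpair (hnat 3) (HC (cimage code_fm S))"
| "code_fm (Disj S) = hpair (hnat 4) (HC (cimage code_fm S))"
| "code_fm (Ex f) = hpair (hnat 5) (code_fm f)"
| "code_fm (All f) = hpair (hnat 6) (code_fm f)"

definition code_th :: "fm set \<Rightarrow> hc" where
  "code_th S = hset (code_fm ` S)"

text \<open>Formulas of the language of set theory, with named variables; in \<open>SBEx x y f\<close>, that is
  \<open>\<exists>x\<in>y. f\<close>, the variable \<open>y\<close> is evaluated before \<open>x\<close> is bound.\<close>

datatype sfm = SMem nat nat | SEq nat nat | SNeg sfm | SAnd sfm sfm | SBEx nat nat sfm | SEx nat sfm

primrec ssat :: "hc set \<Rightarrow> sfm \<Rightarrow> (nat \<Rightarrow> hc) \<Rightarrow> bool" where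
  "ssat A (SMem x y) e \<longleftrightarrow> e x \<in> elts (e y)"
| "ssat A (SEq x y) e \<longleftrightarrow> e x = e y"
| "ssat A (SNeg f) e \<longleftrightarrow> \<not> ssat A f e"
| "ssat A (SAnd f g) e \<longleftrightarrow> ssat A f e \<and> ssat A g e"
| "ssat A (SBEx x y f) e \<longleftrightarrow> (\<exists>a\<in>A. a \<in> elts (e y) \<and> ssat A f (e(x := a)))"
| "ssat A (SEx x f) e \<longleftrightarrow> (\<exists>a\<in>A. ssat A f (e(x := a)))"

primrec Delta0 :: "sfm \<Rightarrow> bool" where
  "Delta0 (SMem x y) \<longleftrightarrow> True"
| "Delta0 (SEq x y) \<longleftrightarrow> True"
| "Delta0 (SNeg f) \<longleftrightarrow> Delta0 f"
| "Delta0 (SAnd f g) \<longleftrightarrow> Delta0 f \<and> Delta0 g"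
| "Delta0 (SBEx x y f) \<longleftrightarrow> Delta0 f"
| "Delta0 (SEx x f) \<longleftrightarrow> False"

inductive Sigma1 :: "sfm \<Rightarrow> bool" where
  "Delta0 f \<Longrightarrow> Sigma1 f"
| "Sigma1 f \<Longrightarrow> Sigma1 (SEx x f)"

text \<open>Parameters from \<open>A\<close> are allowed.\<close>

definition Sigma1_over :: "hc set \<Rightarrow> (hc \<times> hc) set \<Rightarrow> bool" where
  "Sigma1_over A R \<longleftrightarrow> (\<exists>f e. Sigma1 f \<and> range e \<subseteq> A \<and>
     R = {(x, y) \<in> A \<times> A. ssat A f (e(0 := x, 1 := y))})"

definition Delta1_over :: "hc set \<Rightarrow> (hc \<times> hc) set \<Rightarrow> bool" where
  "Delta1_over A R \<longleftrightarrow> Sigma1_over A R \<and> Sigma1_over A (A \<times> A - R)"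

definition Def :: "hc set \<Rightarrow> hc set" where
  "Def A = {x. \<exists>f e. range e \<subseteq> A \<and> elts x = {a \<in> A. ssat A f (e(0 := a))}}"

inductive_set tcl :: "hc \<Rightarrow> hc set" for t where
  "t \<in> tcl t"
| "x \<in> tcl t \<Longrightarrow> y \<in> elts x \<Longrightarrow> y \<in> tcl t"

text \<open>\<open>L(\<alpha>, t)\<close> and \<open>L(\<omega>\<^sub>1, t)\<close>; the hierarchy starts with the transitive closure of \<open>{t}\<close>.\<close>

definition Lrel :: "omega1 \<Rightarrow> hc \<Rightarrow> hc set" where
  "Lrel a t = trec (tcl t) Def a"

definition Lrel_omega1 :: "hc \<Rightarrow> hc set" where
  "Lrel_omega1 t = (\<Union>a. Lrel a t)"

definition admissible :: "hc set \<Rightarrow> bool" where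
  "admissible A \<longleftrightarrow>
     A \<noteq> {} \<and> (\<forall>x\<in>A. elts x \<subseteq> A) \<and>
     (\<forall>x\<in>A. \<forall>y\<in>A. hset {x, y} \<in> A) \<and>
     (\<forall>x\<in>A. hset (\<Union> (elts ` elts x)) \<in> A) \<and>
     (\<forall>f e x. Delta0 f \<and> range e \<subseteq> A \<and> x \<in> A \<longrightarrow>
        hset {a \<in> elts x. ssat A f (e(0 := a))} \<in> A) \<and>
     (\<forall>f e x. Delta0 f \<and> range e \<subseteq> A \<and> x \<in> A \<and>
        (\<forall>a\<in>elts x. \<exists>b\<in>A. ssat A f (e(0 := a, 1 := b))) \<longrightarrow>
        (\<exists>y\<in>A. \<forall>a\<in>elts x. \<exists>b\<in>elts y. ssat A f (e(0 := a, 1 := b))))"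

section \<open>Relative computability\<close>

text \<open>Programs for the partial recursive functions with an oracle \<open>X\<close>. In \<open>OPrec f g\<close> the recursion
  variable is the first argument and \<open>g\<close> receives it, the previous value and the parameters.\<close>

datatype oprog = OZero | OSucc | OProj nat | Orac | OComp oprog "oprog list" | OPrec oprog oprog | OMu oprog

inductive oeval :: "nat set \<Rightarrow> oprog \<Rightarrow> nat list \<Rightarrow> nat \<Rightarrow> bool" for X where
  "oeval X OZero xs 0"
| "oeval X OSucc (x # xs) (Suc x)"
| "i < length xs \<Longrightarrow> oeval X (OProj i) xs (xs ! i)"
| "oeval X Orac (x # xs) (if x \<in> X then 1 else 0)"
| "list_all2 (\<lambda>g y. oeval X g xs y) gs ys \<Longrightarrow> oeval X f ys z \<Longrightarrow> oeval X (OComp f gs) xs z"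
| "oeval X f xs y \<Longrightarrow> oeval X (OPrec f g) (0 # xs) y"
| "oeval X (OPrec f g) (n # xs) y \<Longrightarrow> oeval X g (n # y # xs) z \<Longrightarrow> oeval X (OPrec f g) (Suc n # xs) z"
| "oeval X f (y # xs) 0 \<Longrightarrow> \<forall>i<y. \<exists>v>0. oeval X f (i # xs) v \<Longrightarrow> oeval X (OMu f) xs y"

definition computable_in :: "nat set \<Rightarrow> nat set \<Rightarrow> bool" where
  "computable_in X A \<longleftrightarrow> (\<exists>p. \<forall>n. oeval X p [n] (if n \<in> A then 1 else 0))"

text \<open>\<open>\<omega>\<^sub>1\<^sup>X\<close>: the least ordinal without an \<open>X\<close>-computable presentation.\<close>

definition omega1_set :: "nat set \<Rightarrow> omega1" where
  "omega1_set X = (LEAST a. \<not> (\<exists>r. has_otype r a \<and> computable_in X (prod_encode ` r)))"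

text \<open>The atomic diagram of a structure with domain contained in \<open>\<omega>\<close>, as a set of natural
  numbers.\<close>

definition diagram :: "vocab \<Rightarrow> struc \<Rightarrow> nat set" where
  "diagram V M = list_encode `
     ({[0, a] | a. a \<in> Dom M} \<union>
      {1 # k # xs | k xs. rel_ar V k = Some (length xs) \<and> set xs \<subseteq> Dom M \<and> relI M k xs} \<union>
      {2 # k # funI M k xs # xs | k xs. fun_ar V k = Some (length xs) \<and> set xs \<subseteq> Dom M})"

definition computes_copy :: "vocab \<Rightarrow> nat set \<Rightarrow> struc \<Rightarrow> bool" where
  "computes_copy V X M \<longleftrightarrow> (\<exists>N. is_struc V N \<and> iso V M N \<and> computable_in X (diagram V N))"

definition omega1_struc :: "vocab \<Rightarrow> struc \<Rightarrow> omega1" where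
  "omega1_struc V M = (LEAST a. \<exists>X. computes_copy V X M \<and> a = omega1_set X)"

section \<open>The data supplied by Sacks' theorem\<close>

text \<open>\<open>Ts \<delta>\<close> is the node \<open>T\<^sub>\<delta>\<close> of the branch and \<open>Ls \<delta>\<close> its fragment.\<close>

definition sacks_branch ::
  "vocab \<Rightarrow> fm \<Rightarrow> (omega1 \<Rightarrow> fm set) \<Rightarrow> (omega1 \<Rightarrow> fm set) \<Rightarrow> bool" where
  "sacks_branch V \<phi> Ls Ts \<longleftrightarrow>
     (\<forall>d. node V \<phi> d (Ls d) (Ts d)) \<and>
     (\<forall>d d'. d \<le> d' \<longrightarrow> Ts d \<subseteq> Ts d') \<and>
     (\<forall>d. child V (Ls d) (Ts d) (Ls (osucc d)) (Ts (osucc d))) \<and>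
     (\<forall>l. is_limit l \<longrightarrow> Ls l = (\<Union>d\<in>{..<l}. Ls d) \<and> Ts l = (\<Union>d\<in>{..<l}. Ts d)) \<and>
     Delta1_over (Lrel_omega1 (code_th (base_T V \<phi>))) {(hord d, code_th (Ts d)) | d. True} \<and>
     (\<forall>d. \<exists>A. atomic_model V (Ls d) (Ts d) A \<and> sr_Sacks V A = d)"

text \<open>Any club with the stated properties is admitted, in particular the one obtained from the
  collapses of the \<open>\<Sigma>\<^sub>1\<close>-hulls in Sacks' proof.\<close>

definition sacks_club ::
  "vocab \<Rightarrow> fm \<Rightarrow> (omega1 \<Rightarrow> fm set) \<Rightarrow> (omega1 \<Rightarrow> fm set) \<Rightarrow> omega1 set \<Rightarrow> bool" where
  "sacks_club V \<phi> Ls Ts C \<longleftrightarrow> club C \<and>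
     (\<forall>l\<in>C. omega < l \<and> admissible (Lrel l (code_th (base_T V \<phi>))) \<and>
        nonprincipal_types V (Ls l) (Ts l) \<noteq> {} \<and>
        countable (nonprincipal_types V (Ls l) (Ts l)))"

definition S_circ :: "vocab \<Rightarrow> fm \<Rightarrow> omega1 set \<Rightarrow> omega1 set" where
  "S_circ V \<phi> C = FF V \<phi> \<inter> C \<inter> {qr V \<phi><..}"

section \<open>Fibers and traces\<close>

definition fiber :: "vocab \<Rightarrow> (omega1 \<Rightarrow> fm set) \<Rightarrow> omega1 \<Rightarrow> struc set" where
  "fiber V Ts l = {M. models_all V M (Ts l) \<and> omega1_struc V M = l}"

text \<open>A type has finitely many free variables, so a tuple realizing it can be extended to an
  assignment of all variables.\<close>

definition realizes :: "struc \<Rightarrow> fm set \<Rightarrow> bool" where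
  "realizes M p \<longleftrightarrow> (\<exists>e\<in>assigns M. \<forall>f\<in>p. sat M f e)"

definition trace ::
  "vocab \<Rightarrow> (omega1 \<Rightarrow> fm set) \<Rightarrow> (omega1 \<Rightarrow> fm set) \<Rightarrow> omega1 \<Rightarrow> struc \<Rightarrow> fm set set" where
  "trace V Ls Ts l M = {p \<in> nonprincipal_types V (Ls l) (Ts l). realizes M p}"

definition Spec ::
  "vocab \<Rightarrow> (omega1 \<Rightarrow> fm set) \<Rightarrow> (omega1 \<Rightarrow> fm set) \<Rightarrow> omega1 \<Rightarrow> fm set set set" where
  "Spec V Ls Ts l = trace V Ls Ts l ` fiber V Ts l"

end

theory Submission
  imports Defs
begin

text \<open>Every formula of \<open>L\<^bsub>\<omega>\<^sub>1\<omega>\<^esub>\<close> is equivalent to some \<open>\<Pi>\<^sub>\<alpha>\<close>-formula, and \<open>\<omega>\<^sub>1\<close> is regular. Since \<open>T\<^sub>\<lambda>\<close>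
  has only countably many non-principal types \<open>p\<close>, there is one \<open>\<alpha>\<close> for which all sentences
  \<open>\<exists>x. \<And>p(x)\<close> are \<open>\<Pi>\<^sub>\<alpha>\<close>. Hence the trace of a model of \<open>\<phi>\<close> depends only on its \<open>\<equiv>\<^sub>\<alpha>\<close>-class, and
  by scatteredness there are only countably many such classes.\<close>

section \<open>Countable sets of countable ordinals are bounded\<close>

lemma uncountable_UNIV_omega1:
  includes cardinal_syntax
  shows "\<not> countable (UNIV :: omega1 set)"
proof
  assume "countable (UNIV :: omega1 set)"
  then have "countable (range Rep_omega1)" by blast
  then have "countable (Field (cardSuc natLeq))"
    using type_definition.Rep_range[OF type_definition_omega1] by simp
  then have "|Field (cardSuc natLeq)| \<le>o |UNIV :: nat set|"
    by (simp add: countable_card_of_nat)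
  then have "|Field (cardSuc natLeq)| \<le>o natLeq"
    using card_of_nat ordLeq_ordIso_trans by blast
  then have "cardSuc natLeq \<le>o natLeq"
    using card_of_Field_ordIso[OF Card_order_cardSuc_natLeq] ordIso_ordLeq_trans
      ordIso_symmetric by blast
  moreover have "natLeq <o cardSuc natLeq"
    by (rule cardSuc_greater[OF natLeq_Card_order])
  ultimately show False
    using not_ordLess_ordLeq by blast
qed

text \<open>Proper initial segments of a cardinal order have strictly smaller cardinality, and
  strictly below the successor of \<open>natLeq\<close> means at most \<open>natLeq\<close>.\<close>

lemma countable_lessThan_omega1:
  includes cardinal_syntax
  shows "countable {..<a :: omega1}"
proof -
  let ?r = "cardSuc natLeq"
  have "|underS ?r (Rep_omega1 a)| <o ?r"
    by (rule card_of_underS[OF Card_order_cardSuc_natLeq Rep_omega1])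
  then have "|underS ?r (Rep_omega1 a)| \<le>o natLeq"
    using cardSuc_ordLeq_ordLess[OF natLeq_Card_order card_of_Card_order] by blast
  then have "countable (underS ?r (Rep_omega1 a))"
    by (simp add: countable_card_le_natLeq)
  moreover have "Rep_omega1 ` {..<a} \<subseteq> underS ?r (Rep_omega1 a)"
    by (auto simp: underS_def less_omega1_def less_eq_omega1_def Rep_omega1_inject)
  ultimately have "countable (Rep_omega1 ` {..<a})"
    by (rule countable_subset[rotated])
  then show ?thesis
    by (rule countable_image_inj_on) (auto simp: inj_on_def Rep_omega1_inject)
qed

text \<open>Regularity: if no strict bound exists, every \<open>b\<close> lies at or below some
  element of \<open>A\<close>, so the segments below the successors of these elements cover
  everything. That would be a countable union of countable sets.\<close>

lemma countable_bounded_omega1: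
  assumes "countable (A :: omega1 set)"
  shows "\<exists>b. \<forall>a\<in>A. a < b"
proof (rule HOL.ccontr)
  assume unbounded: "\<nexists>b. \<forall>a\<in>A. a < b"
  have "UNIV = (\<Union>a\<in>A. {..<osucc a})"
  proof -
    have "\<exists>a\<in>A. b < osucc a" for b
      using unbounded less_osucc by (meson leI le_less_trans)
    then show ?thesis by auto
  qed
  moreover have "countable (\<Union>a\<in>A. {..<osucc a})"
    using assms countable_lessThan_omega1 by blast
  ultimately show False
    using uncountable_UNIV_omega1 by simp
qed

section \<open>Syntax and satisfaction\<close>

lemma zero_less_osucc: "0 < osucc a"
  unfolding zero_omega1_def by (metis Least_le le_less_trans less_osucc)

lemma val_cong: "(\<And>n. n \<in> fv_tm t \<Longrightarrow> e n = e' n) \<Longrightarrow> val M e t = val M e' t"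
proof (induction t)
  case (Fn k ts)
  then have "map (val M e) ts = map (val M e') ts" by auto
  then show ?case by (metis val.simps(2))
qed simp

lemma sat_cong: "(\<And>n. n \<in> fv f \<Longrightarrow> e n = e' n) \<Longrightarrow> sat M f e \<longleftrightarrow> sat M f e'"
proof (induction f arbitrary: e e')
  case (Eq s t)
  then show ?case using val_cong[of s e e'] val_cong[of t e e'] by simp
next
  case (Rel k ts)
  then have "map (val M e) ts = map (val M e') ts"
    by (auto intro!: val_cong)
  then show ?case by (metis sat.simps(2))
next
  case (Neg f)
  have "sat M f e \<longleftrightarrow> sat M f e'"
    using Neg.prems by (intro Neg.IH) simp
  then show ?case by simp
next
  case (Conj S)
  have "sat M f e \<longleftrightarrow> sat M f e'" if "f \<in> rcset S" for f
    using that Conj.prems by (intro Conj.IH) (auto simp: cimage.rep_eq)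
  then show ?case by (simp add: cimage.rep_eq)
next
  case (Disj S)
  have "sat M f e \<longleftrightarrow> sat M f e'" if "f \<in> rcset S" for f
    using that Disj.prems by (intro Disj.IH) (auto simp: cimage.rep_eq)
  then show ?case by (simp add: cimage.rep_eq)
next
  case (Ex f)
  have "sat M f (case_nat a e) \<longleftrightarrow> sat M f (case_nat a e')" for a
    using Ex.prems by (intro Ex.IH) (auto split: nat.split)
  then show ?case by simp
next
  case (All f)
  have "sat M f (case_nat a e) \<longleftrightarrow> sat M f (case_nat a e')" for a
    using All.prems by (intro All.IH) (auto split: nat.split)
  then show ?case by simp
qed

lemma in_sig_Exs: "in_sig V (Exs n f) \<longleftrightarrow> in_sig V f"
  by (induction n) (auto simp: Exs_def)

lemma fv_Exs: "fv (Exs n f) = {k. n + k \<in> fv f}"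
  by (induction n) (auto simp: Exs_def)

text \<open>With de Bruijn indices a block of \<open>n\<close> quantifiers binds the indices below
  \<open>n\<close> and moves the outer variables up by \<open>n\<close>. This form lets a whole
  tuple be chosen at once.\<close>

lemma sat_Exs:
  "sat M (Exs n f) e \<longleftrightarrow>
     (\<exists>e'. (\<forall>i<n. e' i \<in> Dom M) \<and> (\<forall>i. e' (n + i) = e i) \<and> sat M f e')"
proof (induction n arbitrary: e)
  case 0
  have "(\<forall>i. e' i = e i) \<longleftrightarrow> e' = e" for e' :: "nat \<Rightarrow> nat" by auto
  then show ?case by (simp add: Exs_def)
next
  case (Suc n)
  have "sat M (Exs (Suc n) f) e \<longleftrightarrow> (\<exists>a\<in>Dom M. sat M (Exs n f) (case_nat a e))"
    by (simp add: Exs_def)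
  \<comment> \<open>The outermost witness \<open>a\<close> is index 0 for the remaining block of
    \<open>n\<close> quantifiers, hence index \<open>n\<close> of the final assignment.\<close>
  also have "\<dots> \<longleftrightarrow> (\<exists>a\<in>Dom M. \<exists>e'. (\<forall>i<n. e' i \<in> Dom M) \<and>
      (e' n = a \<and> (\<forall>i. e' (Suc n + i) = e i)) \<and> sat M f e')"
  proof -
    have "(\<forall>i. P i) \<longleftrightarrow> P 0 \<and> (\<forall>i. P (Suc i))" for P
      by (metis not0_implies_Suc)
    from this[of "\<lambda>i. e' (n + i) = case_nat a e i" for a e']
    have "(\<forall>i. e' (n + i) = case_nat a e i) \<longleftrightarrow> e' n = a \<and> (\<forall>i. e' (Suc n + i) = e i)"
      for a and e' :: "nat \<Rightarrow> nat"
      by simp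
    then show ?thesis by (simp only: Suc.IH)
  qed
  also have "\<dots> \<longleftrightarrow> (\<exists>e'. (\<forall>i<Suc n. e' i \<in> Dom M) \<and> (\<forall>i. e' (Suc n + i) = e i) \<and> sat M f e')"
    unfolding All_less_Suc by blast
  finally show ?case .
qed

section \<open>Infinitary formulas lie in the hierarchy\<close>

text \<open>The classes are syntactic: at positive levels a formula must literally be a disjunction
  (dually, a conjunction). Changing sides therefore takes a singleton connective over an empty
  quantifier block.\<close>

lemma sigma_in_wrap:
  assumes "pi_in a f" and "a < b"
  shows "sigma_in b (Disj (csingle f))"
proof (rule sigma_pos)
  show "0 < b"
    using zero_less_osucc osucc_le[OF assms(2)] by (rule less_le_trans)
  have "f = Exs 0 f" by (simp add: Exs_def)
  then show "\<forall>h\<in>rcset (csingle f). \<exists>c<b. \<exists>n g. h = Exs n g \<and> pi_in c g"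
    using assms by (auto simp: cinsert.rep_eq bot_cset.rep_eq)
qed

lemma pi_in_wrap:
  assumes "sigma_in a f" and "a < b"
  shows "pi_in b (Conj (csingle f))"
proof (rule pi_pos)
  show "0 < b"
    using zero_less_osucc osucc_le[OF assms(2)] by (rule less_le_trans)
  have "f = Alls 0 f" by (simp add: Alls_def)
  then show "\<forall>h\<in>rcset (csingle f). \<exists>c<b. \<exists>n g. h = Alls n g \<and> sigma_in c g"
    using assms by (auto simp: cinsert.rep_eq bot_cset.rep_eq)
qed

text \<open>The hierarchy holds normal forms only, so an arbitrary formula can be placed in it just
  up to equivalence. Ranging over all \<open>M\<close> and \<open>e\<close> avoids side conditions
  under quantifiers, and the bound on free variables sends sentences to sentences.\<close>

definition pi_equivalent :: "vocab \<Rightarrow> omega1 \<Rightarrow> fm \<Rightarrow> bool" where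
  "pi_equivalent V a f \<longleftrightarrow>
     (\<exists>g. pi_in a g \<and> in_sig V g \<and> fv g \<subseteq> fv f \<and> (\<forall>M e. sat M g e \<longleftrightarrow> sat M f e))"

definition sigma_equivalent :: "vocab \<Rightarrow> omega1 \<Rightarrow> fm \<Rightarrow> bool" where
  "sigma_equivalent V a f \<longleftrightarrow>
     (\<exists>g. sigma_in a g \<and> in_sig V g \<and> fv g \<subseteq> fv f \<and> (\<forall>M e. sat M g e \<longleftrightarrow> sat M f e))"

lemma pi_equivalent_if_finitary_qf:
  "finitary_qf f \<Longrightarrow> in_sig V f \<Longrightarrow> pi_equivalent V 0 f"
  unfolding pi_equivalent_def using pi_0 by blast

lemma sigma_equivalent_if_pi: "pi_equivalent V a f \<Longrightarrow> a < b \<Longrightarrow> sigma_equivalent V b f"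
  unfolding pi_equivalent_def sigma_equivalent_def
  by (elim HOL.exE, rule_tac x = "Disj (csingle g)" in HOL.exI)
    (auto simp: cimage.rep_eq cinsert.rep_eq bot_cset.rep_eq sigma_in_wrap)

lemma pi_equivalent_if_sigma: "sigma_equivalent V a f \<Longrightarrow> a < b \<Longrightarrow> pi_equivalent V b f"
  unfolding pi_equivalent_def sigma_equivalent_def
  by (elim HOL.exE, rule_tac x = "Conj (csingle g)" in HOL.exI)
    (auto simp: cimage.rep_eq cinsert.rep_eq bot_cset.rep_eq pi_in_wrap)

text \<open>Wrapping always switches sides, so the way up leads through a \<Sigma>-form at level
  \<open>osucc a\<close>; this causes the gap in the hypothesis.\<close>

lemma pi_equivalent_mono: "pi_equivalent V a f \<Longrightarrow> osucc a < b \<Longrightarrow> pi_equivalent V b f"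
  using sigma_equivalent_if_pi pi_equivalent_if_sigma less_osucc by blast

text \<open>Either side embeds into the other one level up; once the level is left open, the
  induction on formulas may use whichever side is convenient.\<close>

lemma ex_sigma_iff_ex_pi: "(\<exists>a. sigma_equivalent V a f) \<longleftrightarrow> (\<exists>a. pi_equivalent V a f)"
  using sigma_equivalent_if_pi pi_equivalent_if_sigma less_osucc by blast

lemma pi_equivalent_cong:
  "pi_equivalent V a f \<Longrightarrow> fv f \<subseteq> fv f' \<Longrightarrow> (\<And>M e. sat M f e \<longleftrightarrow> sat M f' e) \<Longrightarrow>
    pi_equivalent V a f'"
  unfolding pi_equivalent_def by blast

lemma sigma_equivalent_cong:
  "sigma_equivalent V a f \<Longrightarrow> fv f \<subseteq> fv f' \<Longrightarrow> (\<And>M e. sat M f e \<longleftrightarrow> sat M f' e) \<Longrightarrow>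
    sigma_equivalent V a f'"
  unfolding sigma_equivalent_def by blast

text \<open>The countably many levels of the conjuncts have a common strict bound by regularity, and
  each conjunct enters the normal form behind an empty quantifier block.\<close>

lemma pi_equivalent_Conj:
  assumes "\<And>f. f \<in> rcset S \<Longrightarrow> \<exists>a. sigma_equivalent V a f"
  shows "\<exists>a. pi_equivalent V a (Conj S)"
proof -
  obtain a where "\<And>f. f \<in> rcset S \<Longrightarrow> sigma_equivalent V (a f) f"
    using assms by metis
  then have "\<forall>f\<in>rcset S. \<exists>g. sigma_in (a f) g \<and> in_sig V g \<and> fv g \<subseteq> fv f \<and>
      (\<forall>M e. sat M g e \<longleftrightarrow> sat M f e)"
    by (simp add: sigma_equivalent_def)
  then obtain g where g: "\<forall>f\<in>rcset S. sigma_in (a f) (g f) \<and> in_sig V (g f) \<and>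
      fv (g f) \<subseteq> fv f \<and> (\<forall>M e. sat M (g f) e \<longleftrightarrow> sat M f e)"
    by metis
  have "countable (a ` rcset S)" using rcset by blast
  then obtain b where b: "\<And>f. f \<in> rcset S \<Longrightarrow> a f < b"
    using countable_bounded_omega1[of "a ` rcset S"] by auto
  have "pi_in (osucc b) (Conj (cimage g S))"
  proof (rule pi_pos[OF zero_less_osucc], rule ballI)
    fix h assume "h \<in> rcset (cimage g S)"
    then obtain f where f: "f \<in> rcset S" "h = g f" by (auto simp: cimage.rep_eq)
    then have "h = Alls 0 h" "sigma_in (a f) h" "a f < osucc b"
      using g b less_trans[OF b less_osucc] by (auto simp: Alls_def)
    then show "\<exists>b'<osucc b. \<exists>n g. h = Alls n g \<and> sigma_in b' g" by blast
  qed
  moreover have "fv (Conj (cimage g S)) \<subseteq> fv (Conj S)"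
    using g by (fastforce simp: cimage.rep_eq)
  ultimately have "pi_equivalent V (osucc b) (Conj S)"
    unfolding pi_equivalent_def using g
    by (intro HOL.exI[of _ "Conj (cimage g S)"]) (simp add: cimage.rep_eq)
  then show ?thesis ..
qed

lemma sigma_equivalent_Disj:
  assumes "\<And>f. f \<in> rcset S \<Longrightarrow> \<exists>a. pi_equivalent V a f"
  shows "\<exists>a. sigma_equivalent V a (Disj S)"
proof -
  obtain a where "\<And>f. f \<in> rcset S \<Longrightarrow> pi_equivalent V (a f) f"
    using assms by metis
  then have "\<forall>f\<in>rcset S. \<exists>g. pi_in (a f) g \<and> in_sig V g \<and> fv g \<subseteq> fv f \<and>
      (\<forall>M e. sat M g e \<longleftrightarrow> sat M f e)"
    by (simp add: pi_equivalent_def)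
  then obtain g where g: "\<forall>f\<in>rcset S. pi_in (a f) (g f) \<and> in_sig V (g f) \<and>
      fv (g f) \<subseteq> fv f \<and> (\<forall>M e. sat M (g f) e \<longleftrightarrow> sat M f e)"
    by metis
  have "countable (a ` rcset S)" using rcset by blast
  then obtain b where b: "\<And>f. f \<in> rcset S \<Longrightarrow> a f < b"
    using countable_bounded_omega1[of "a ` rcset S"] by auto
  have "sigma_in (osucc b) (Disj (cimage g S))"
  proof (rule sigma_pos[OF zero_less_osucc], rule ballI)
    fix h assume "h \<in> rcset (cimage g S)"
    then obtain f where f: "f \<in> rcset S" "h = g f" by (auto simp: cimage.rep_eq)
    then have "h = Exs 0 h" "pi_in (a f) h" "a f < osucc b"
      using g b less_trans[OF b less_osucc] by (auto simp: Exs_def)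
    then show "\<exists>b'<osucc b. \<exists>n g. h = Exs n g \<and> pi_in b' g" by blast
  qed
  moreover have "fv (Disj (cimage g S)) \<subseteq> fv (Disj S)"
    using g by (fastforce simp: cimage.rep_eq)
  ultimately have "sigma_equivalent V (osucc b) (Disj S)"
    unfolding sigma_equivalent_def using g
    by (intro HOL.exI[of _ "Disj (cimage g S)"]) (simp add: cimage.rep_eq)
  then show ?thesis ..
qed

lemma sigma_equivalent_Ex:
  assumes "pi_equivalent V a f"
  shows "sigma_equivalent V (osucc a) (Ex f)"
proof -
  obtain g where g: "pi_in a g" "in_sig V g" "fv g \<subseteq> fv f"
    "\<And>M e. sat M g e \<longleftrightarrow> sat M f e"
    using assms unfolding pi_equivalent_def by blast
  have "Ex g = Exs 1 g" by (simp add: Exs_def)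
  then have "sigma_in (osucc a) (Disj (csingle (Ex g)))"
    using g(1) less_osucc by (intro sigma_pos[OF zero_less_osucc])
      (auto simp: cinsert.rep_eq bot_cset.rep_eq)
  then show ?thesis
    unfolding sigma_equivalent_def using g
    by (intro HOL.exI[of _ "Disj (csingle (Ex g))"])
      (auto simp: cimage.rep_eq cinsert.rep_eq bot_cset.rep_eq)
qed

lemma pi_equivalent_All:
  assumes "sigma_equivalent V a f"
  shows "pi_equivalent V (osucc a) (All f)"
proof -
  obtain g where g: "sigma_in a g" "in_sig V g" "fv g \<subseteq> fv f"
    "\<And>M e. sat M g e \<longleftrightarrow> sat M f e"
    using assms unfolding sigma_equivalent_def by blast
  have "All g = Alls 1 g" by (simp add: Alls_def)
  then have "pi_in (osucc a) (Conj (csingle (All g)))"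
    using g(1) less_osucc by (intro pi_pos[OF zero_less_osucc])
      (auto simp: cinsert.rep_eq bot_cset.rep_eq)
  then show ?thesis
    unfolding pi_equivalent_def using g
    by (intro HOL.exI[of _ "Conj (csingle (All g))"])
      (auto simp: cimage.rep_eq cinsert.rep_eq bot_cset.rep_eq)
qed

text \<open>Carrying the negation along in the induction replaces a separate duality argument.\<close>

lemma ex_pi_equivalent_and_Neg:
  "in_sig V f \<Longrightarrow> (\<exists>a. pi_equivalent V a f) \<and> (\<exists>a. pi_equivalent V a (Neg f))"
proof (induction f)
  case (Eq s t)
  then have "pi_equivalent V 0 (Eq s t)" "pi_equivalent V 0 (Neg (Eq s t))"
    by (simp_all add: pi_equivalent_if_finitary_qf)
  then show ?case by blast
next
  case (Rel k ts)
  then have "pi_equivalent V 0 (Rel k ts)" "pi_equivalent V 0 (Neg (Rel k ts))"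
    by (simp_all add: pi_equivalent_if_finitary_qf)
  then show ?case by blast
next
  case (Neg f)
  have "pi_equivalent V a (Neg (Neg f))" if "pi_equivalent V a f" for a
    using that by (rule pi_equivalent_cong) auto
  with Neg show ?case by auto
next
  case (Conj S)
  then have IH: "(\<exists>a. pi_equivalent V a f) \<and> (\<exists>a. pi_equivalent V a (Neg f))"
    if "f \<in> rcset S" for f
    using that by (auto simp: cimage.rep_eq)
  \<comment> \<open>De Morgan: the half of the induction hypothesis about negations supplies the
    disjuncts.\<close>
  then obtain a where "sigma_equivalent V a (Disj (cimage Neg S))"
    using sigma_equivalent_Disj[of "cimage Neg S" V] by (auto simp: cimage.rep_eq)
  then have "sigma_equivalent V a (Neg (Conj S))"
    by (rule sigma_equivalent_cong) (auto simp: cimage.rep_eq)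
  moreover have "\<exists>a. pi_equivalent V a (Conj S)"
    using IH by (intro pi_equivalent_Conj) (simp add: ex_sigma_iff_ex_pi)
  ultimately show ?case using ex_sigma_iff_ex_pi by blast
next
  case (Disj S)
  then have IH: "(\<exists>a. pi_equivalent V a f) \<and> (\<exists>a. pi_equivalent V a (Neg f))"
    if "f \<in> rcset S" for f
    using that by (auto simp: cimage.rep_eq)
  then obtain a where "pi_equivalent V a (Conj (cimage Neg S))"
    using pi_equivalent_Conj[of "cimage Neg S" V] by (auto simp: cimage.rep_eq ex_sigma_iff_ex_pi)
  then have "pi_equivalent V a (Neg (Disj S))"
    by (rule pi_equivalent_cong) (auto simp: cimage.rep_eq)
  moreover have "\<exists>a. sigma_equivalent V a (Disj S)"
    using IH by (intro sigma_equivalent_Disj) simp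
  ultimately show ?case using ex_sigma_iff_ex_pi by blast
next
  case (Ex f)
  \<comment> \<open>The sides are chosen to fit the quantifiers: \<open>Ex\<close> acts on a
    \<Pi>-form of \<open>f\<close>, while \<open>Neg (Ex f)\<close> becomes
    \<open>All (Neg f)\<close> and needs a \<Sigma>-form of \<open>Neg f\<close>.\<close>
  then obtain a b where "pi_equivalent V a f" "sigma_equivalent V b (Neg f)"
    using ex_sigma_iff_ex_pi[of V "Neg f"] by auto
  then have "sigma_equivalent V (osucc a) (Ex f)" "pi_equivalent V (osucc b) (All (Neg f))"
    by (auto intro: sigma_equivalent_Ex pi_equivalent_All)
  moreover from this(2) have "pi_equivalent V (osucc b) (Neg (Ex f))"
    by (rule pi_equivalent_cong) auto
  ultimately show ?case using ex_sigma_iff_ex_pi by blast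
next
  case (All f)
  then obtain a b where "sigma_equivalent V a f" "pi_equivalent V b (Neg f)"
    using ex_sigma_iff_ex_pi[of V f] by auto
  then have "pi_equivalent V (osucc a) (All f)" "sigma_equivalent V (osucc b) (Ex (Neg f))"
    by (auto intro: sigma_equivalent_Ex pi_equivalent_All)
  moreover from this(2) have "sigma_equivalent V (osucc b) (Neg (All f))"
    by (rule sigma_equivalent_cong) auto
  ultimately show ?case using ex_sigma_iff_ex_pi by blast
qed

lemma countable_uniform_pi_sentences:
  assumes "countable F" and "\<And>f. f \<in> F \<Longrightarrow> sentence V f"
  shows "\<exists>a. \<forall>f\<in>F. \<exists>g. sentence V g \<and> pi_in a g \<and> (\<forall>M. models M g \<longleftrightarrow> models M f)"
proof -
  have "\<exists>a. pi_equivalent V a f" if "f \<in> F" for f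
    using assms(2)[OF that] ex_pi_equivalent_and_Neg by (auto simp: sentence_def)
  then obtain a where a: "\<And>f. f \<in> F \<Longrightarrow> pi_equivalent V (a f) f" by metis
  \<comment> \<open>Bounding the successors, not just the levels, provides the gap demanded by
    \<open>pi_equivalent_mono\<close>.\<close>
  obtain b where "\<And>f. f \<in> F \<Longrightarrow> osucc (a f) < b"
    using countable_bounded_omega1[of "(\<lambda>f. osucc (a f)) ` F"] assms(1) by auto
  then have b: "pi_equivalent V b f" if "f \<in> F" for f
    using a pi_equivalent_mono that by blast
  show ?thesis
  proof (intro HOL.exI[of _ b] ballI)
    fix f assume f: "f \<in> F"
    from b[OF f] obtain g where "pi_in b g" "in_sig V g" "fv g \<subseteq> fv f"
      "\<And>M e. sat M g e \<longleftrightarrow> sat M f e"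
      unfolding pi_equivalent_def by blast
    then show "\<exists>g. sentence V g \<and> pi_in b g \<and> (\<forall>M. models M g \<longleftrightarrow> models M f)"
      using assms(2)[OF f] by (auto simp: sentence_def models_def)
  qed
qed

section \<open>Traces\<close>

text \<open>Only the values below \<open>n\<close> matter to \<open>p\<close>, so a realizing
  assignment amounts to an \<open>n\<close>-tuple. Countability ensures that \<open>acset p\<close>
  has exactly the members of \<open>p\<close>.\<close>

lemma realizes_iff_models:
  assumes "countable p" and "\<And>f. f \<in> p \<Longrightarrow> fv f \<subseteq> {..<n}" and "Dom M \<noteq> {}"
  shows "realizes M p \<longleftrightarrow> models M (Exs n (Conj (acset p)))"
proof
  assume "realizes M p"
  then obtain e where e: "e \<in> assigns M" "\<And>f. f \<in> p \<Longrightarrow> sat M f e"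
    unfolding realizes_def by blast
  have "sat M (Exs n (Conj (acset p))) e'" for e'
  proof -
    \<comment> \<open>The realizing tuple is placed in front of the given outer assignment.\<close>
    let ?e = "\<lambda>i. if i < n then e i else e' (i - n)"
    have "sat M f ?e" if "f \<in> p" for f
      using e(2)[OF that] assms(2)[OF that] by (subst sat_cong[of f _ e]) auto
    moreover have "\<forall>i<n. ?e i \<in> Dom M"
      using e(1) by (auto simp: assigns_def)
    ultimately show ?thesis
      unfolding sat_Exs using assms(1)
      by (intro HOL.exI[of _ ?e]) (simp add: cimage.rep_eq)
  qed
  then show "models M (Exs n (Conj (acset p)))" by (simp add: models_def)
next
  assume models: "models M (Exs n (Conj (acset p)))"
  \<comment> \<open>A constant outer assignment keeps all values from index \<open>n\<close> on
    inside the domain, so the assignment found is a legitimate one.\<close>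
  obtain x where x: "x \<in> Dom M" using assms(3) by blast
  then have "(\<lambda>_. x) \<in> assigns M" by (auto simp: assigns_def)
  with models have "sat M (Exs n (Conj (acset p))) (\<lambda>_. x)"
    by (simp only: models_def)
  then obtain e' where e': "\<forall>i<n. e' i \<in> Dom M" "\<forall>i. e' (n + i) = x"
    "sat M (Conj (acset p)) e'"
    by (subst (asm) sat_Exs) (elim HOL.exE HOL.conjE)
  have "e' i \<in> Dom M" for i
    using x e'(1) e'(2)[rule_format, of "i - n"] by (cases "i < n") simp_all
  then have "e' \<in> assigns M" by (auto simp: assigns_def)
  then show "realizes M p"
    using e'(3) assms(1) by (auto simp: realizes_def cimage.rep_eq)
qed

section \<open>Fragments and models along the branch\<close>

lemma subset_frag_gen: "X \<subseteq> frag_gen V X"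
  by (auto simp: frag_gen_def)

text \<open>\<open>child\<close> guarantees that the next set \<open>Ls (osucc d)\<close> is a
  fragment; \<open>Ls d\<close> is among its generators and inherits both properties as a
  subset.\<close>

lemma sacks_branch_fragment:
  assumes "sacks_branch V \<phi> Ls Ts"
  shows "countable (Ls d)" and "f \<in> Ls d \<Longrightarrow> wff V f"
proof -
  have "child V (Ls d) (Ts d) (Ls (osucc d)) (Ts (osucc d))"
    using assms by (simp add: sacks_branch_def)
  then have frag: "fragment V (Ls (osucc d))" and sub: "Ls d \<subseteq> Ls (osucc d)"
    using subset_frag_gen by (fastforce simp: child_def)+
  show "countable (Ls d)"
    using sub frag[unfolded fragment_def, THEN HOL.conjunct1] by (rule countable_subset)
  show "f \<in> Ls d \<Longrightarrow> wff V f"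
    using sub frag[unfolded fragment_def, THEN HOL.conjunct2, THEN HOL.conjunct1] by blast
qed

text \<open>Theories increase along the branch, and the one on level 0 contains \<phi>.\<close>

lemma sacks_branch_models:
  assumes "sacks_branch V \<phi> Ls Ts" and "models_all V M (Ts d)"
  shows "M \<in> Mod V \<phi>"
proof -
  have "node V \<phi> 0 (Ls 0) (Ts 0)" and sub: "Ts 0 \<subseteq> Ts d"
    using assms(1) by (auto simp: sacks_branch_def zero_omega1_def Least_le)
  \<comment> \<open>Inverting \<open>node\<close> at level 0 leaves only the base rule, as 0 is
    neither a successor nor a limit.\<close>
  from this(1) have "base_T V \<phi> \<subseteq> Ts 0"
  proof cases
    case (node_succ d)
    then show ?thesis using zero_less_osucc[of d] by simp
  qed (auto simp: is_limit_def)
  then show ?thesis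
    using sub assms(2) by (auto simp: base_T_def models_all_def Mod_def)
qed

lemma trace_eq_if_equiv_in:
  assumes branch: "sacks_branch V \<phi> Ls Ts"
    and N: "countable (nonprincipal_types V (Ls l) (Ts l))"
  shows "\<exists>a. \<forall>M M'. is_struc V M \<longrightarrow> is_struc V M' \<longrightarrow> equiv_in V a M M' \<longrightarrow>
    trace V Ls Ts l M = trace V Ls Ts l M'"
proof -
  let ?N = "nonprincipal_types V (Ls l) (Ts l)"
  have "\<forall>p\<in>?N. \<exists>n. p \<subseteq> formulas_in (Ls l) n"
    by (auto simp: nonprincipal_types_def node_type_def)
  \<comment> \<open>A type does not carry its arity; any number bounding its free variables serves
    to close it existentially.\<close>
  then obtain ar where ar: "\<And>p. p \<in> ?N \<Longrightarrow> p \<subseteq> formulas_in (Ls l) (ar p)" by metis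
  have cp: "countable p" and fvp: "\<And>f. f \<in> p \<Longrightarrow> in_sig V f \<and> fv f \<subseteq> {..<ar p}" if "p \<in> ?N" for p
    using ar[OF that] sacks_branch_fragment[OF branch, where d = l]
    by (auto simp: formulas_in_def wff_def dest: countable_subset[rotated]
        intro: countable_subset[of p "Ls l"])
  define s where "s p = Exs (ar p) (Conj (acset p))" for p
  have real: "realizes M p \<longleftrightarrow> models M (s p)" if "p \<in> ?N" "is_struc V M" for p M
    unfolding s_def using cp fvp that by (intro realizes_iff_models) (auto simp: is_struc_def)
  have "sentence V f" if "f \<in> s ` ?N" for f
    using that cp fvp
    by (fastforce simp: sentence_def s_def in_sig_Exs fv_Exs cimage.rep_eq)
  moreover have "countable (s ` ?N)" using N by simp
  ultimately obtain a where
    a: "\<forall>f\<in>s ` ?N. \<exists>g. sentence V g \<and> pi_in a g \<and> (\<forall>M. models M g \<longleftrightarrow> models M f)"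
    using countable_uniform_pi_sentences[of "s ` ?N" V] by blast
  have "models M (s p) \<longleftrightarrow> models M' (s p)" if "equiv_in V a M M'" "p \<in> ?N" for M M' p
    using a that unfolding equiv_in_def by (metis imageI)
  then show ?thesis
    using real by (intro HOL.exI[of _ a]) (auto simp: trace_def)
qed

theorem mainTheorem8:
  fixes V :: vocab and \<phi> :: fm and Ls Ts :: "omega1 \<Rightarrow> fm set"
    and C :: "omega1 set" and l :: omega1
  assumes "minimal_counterexample V \<phi>"
    and "sacks_branch V \<phi> Ls Ts"
    and "sacks_club V \<phi> Ls Ts C"
    and "l \<in> S_circ V \<phi> C"
  shows "countable (Spec V Ls Ts l)"
proof -
  have "countable (nonprincipal_types V (Ls l) (Ts l))"
    using assms(3,4) by (auto simp: S_circ_def sacks_club_def)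
  from trace_eq_if_equiv_in[OF assms(2) this] obtain a where
    a: "\<And>M M'. is_struc V M \<Longrightarrow> is_struc V M' \<Longrightarrow> equiv_in V a M M' \<Longrightarrow>
      trace V Ls Ts l M = trace V Ls Ts l M'" by blast
  define R where "R = {(M, N). M \<in> Mod V \<phi> \<and> N \<in> Mod V \<phi> \<and> equiv_in V a M N}"
  \<comment> \<open>The trace is constant on each class, so an arbitrary representative recovers it,
    even one outside the fiber: \<open>a\<close> works for all structures.\<close>
  have "Spec V Ls Ts l \<subseteq> (\<lambda>K. trace V Ls Ts l (SOME M. M \<in> K)) ` equiv_classes V \<phi> a"
  proof
    fix t assume "t \<in> Spec V Ls Ts l"
    then obtain M where M: "models_all V M (Ts l)" "t = trace V Ls Ts l M"
      by (auto simp: Spec_def fiber_def)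
    then have Mod: "M \<in> Mod V \<phi>" using sacks_branch_models[OF assms(2)] by blast
    \<comment> \<open>Reflexivity makes the class nonempty, so the chosen representative really
      belongs to it.\<close>
    then have "M \<in> R `` {M}" by (simp add: R_def equiv_in_def)
    then have "(SOME N. N \<in> R `` {M}) \<in> R `` {M}" by (rule someI)
    then have "t = trace V Ls Ts l (SOME N. N \<in> R `` {M})"
      using a M(2) unfolding R_def Mod_def by blast
    moreover have "R `` {M} \<in> equiv_classes V \<phi> a"
      using Mod by (auto simp: equiv_classes_def R_def quotient_def)
    ultimately show "t \<in> (\<lambda>K. trace V Ls Ts l (SOME M. M \<in> K)) ` equiv_classes V \<phi> a"
      by blast
  qed
  moreover have "countable (equiv_classes V \<phi> a)"
    using assms(1) by (simp add: minimal_counterexample_def scattered_def)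
  ultimately show ?thesis
    by (meson countable_image countable_subset)
qed

end
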